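(* Let $ABC$ be a triangle, and consider points $P$ not on the extended sides of $ABC$ or of $K^{-1}(ABC)$. In homogeneous barycentric coordinates $(x,y,z)$ with respect to $ABC$, the locus of all such points $P$ for which the map $\mathsf{M}=T_P\circ K^{-1}\circ T_{P'}$ is a translation is the set of (real) points of the curve $$\mathcal{E}_S:\quad x(y+z)^2+y(x+z)^2+z(x+y)^2=0$$ minus the six points consisting of the vertices $A,B,C$ and the points at infinity $(0,1,-1),(1,0,-1),(1,-1,0)$ on the sides of $ABC$. The curve $\mathcal{E}_S$ is an elliptic curve, birationally equivalent to $v^2=u(u^2+6u-3)$, with $j$-invariant $54000=2^4 3^3 5^3$.
   Context: Work in the extended Euclidean plane (the Euclidean plane together with the line at infinity $l_\infty$). $ABC$ is an ordinary triangle with centroid $G$. $K$ (complement map) is the homothety with center $G$ and ratio $-1/2$; $K^{-1}(ABC)$ is the anticomplementary triangle. $\iota$ is the isotomic map $(x,y,z)\mapsto(1/x,1/y,1/z)$ in homogeneous barycentric coordinates, and $P'=\iota(P)$. $T_P$ is the unique affine map taking $A,B,C$ to the traces $D=AP\cap BC$, $E=BP\cap CA$, $F=CP\cap AB$ of $P$, respectively, and $T_{P'}$ is the unique affine map taking $A,B,C$ to the corresponding traces of $P'$. It is known that $\mathsf{M}$ is always a homothety or a translation. *)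

theory Defs
  imports "HOL-Analysis.Analysis"
begin

section \<open>The extended Euclidean plane\<close>

text \<open>
  The extended plane is the projective completion of \<^typ>\<open>real^2\<close>: its points are the lines
  through the origin of \<^typ>\<open>(real^2) \<times> real\<close>. The ordinary point \<open>X\<close> is the line spanned by
  \<open>(X, 1)\<close>; the points of \<open>l\<^sub>\<infinity>\<close> are the lines spanned by some \<open>(d, 0)\<close>.
  The lines of the extended plane are planes through the origin, incidence is inclusion.
\<close>

type_synonym pt = "real^2"
type_synonym ext_pt = "((real^2) \<times> real) set"

definition ext_plane :: "ext_pt set" where
  "ext_plane = {span {v} | v. v \<noteq> 0}"

definition ord :: "pt \<Rightarrow> ext_pt" where
  "ord X = span {(X, 1)}"

definition join :: "ext_pt \<Rightarrow> ext_pt \<Rightarrow> ((real^2) \<times> real) set" where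
  "join P Q = span (P \<union> Q)"

definition on_sides :: "pt \<Rightarrow> pt \<Rightarrow> pt \<Rightarrow> ext_pt \<Rightarrow> bool" where
  "on_sides A B C P \<longleftrightarrow>
     P \<subseteq> join (ord B) (ord C) \<or> P \<subseteq> join (ord C) (ord A) \<or> P \<subseteq> join (ord A) (ord B)"

text \<open>The point with homogeneous barycentric coordinates \<open>(v$1, v$2, v$3)\<close>, \<open>v \<noteq> 0\<close>.\<close>

definition bary :: "pt \<Rightarrow> pt \<Rightarrow> pt \<Rightarrow> real^3 \<Rightarrow> ext_pt" where
  "bary A B C v = span {v$1 *\<^sub>R (A, 1) + v$2 *\<^sub>R (B, 1) + v$3 *\<^sub>R (C, 1)}"

section \<open>The maps of cevian geometry\<close>

definition centroid :: "pt \<Rightarrow> pt \<Rightarrow> pt \<Rightarrow> pt" where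
  "centroid A B C = (1/3) *\<^sub>R (A + B + C)"

definition homothety :: "pt \<Rightarrow> real \<Rightarrow> pt \<Rightarrow> pt" where
  "homothety G r X = G + r *\<^sub>R (X - G)"

definition compl_map :: "pt \<Rightarrow> pt \<Rightarrow> pt \<Rightarrow> pt \<Rightarrow> pt" where
  "compl_map A B C = homothety (centroid A B C) (-1/2)"

definition isotomic :: "pt \<Rightarrow> pt \<Rightarrow> pt \<Rightarrow> ext_pt \<Rightarrow> ext_pt" where
  "isotomic A B C P = (THE Q. \<exists>x y z. x \<noteq> 0 \<and> y \<noteq> 0 \<and> z \<noteq> 0 \<and>
     P = bary A B C (vector [x, y, z]) \<and> Q = bary A B C (vector [1/x, 1/y, 1/z]))"

text \<open>
  \<open>cevian_trace A B C P\<close> is the point where \<open>AP\<close> meets \<open>BC\<close>; it is an ordinary point as soon as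
  \<open>P\<close> is not on \<open>BC\<close> and not on the parallel to \<open>BC\<close> through \<open>A\<close>.
\<close>

definition cevian_trace :: "pt \<Rightarrow> pt \<Rightarrow> pt \<Rightarrow> ext_pt \<Rightarrow> pt" where
  "cevian_trace A B C P = (THE D. ord D = join (ord A) P \<inter> join (ord B) (ord C))"

definition affine_map :: "(pt \<Rightarrow> pt) \<Rightarrow> bool" where
  "affine_map f \<longleftrightarrow> (\<exists>g c. linear g \<and> f = (\<lambda>X. g X + c))"

definition T_map :: "pt \<Rightarrow> pt \<Rightarrow> pt \<Rightarrow> ext_pt \<Rightarrow> pt \<Rightarrow> pt" where
  "T_map A B C P = (THE f. affine_map f \<and> f A = cevian_trace A B C P \<and>
     f B = cevian_trace B C A P \<and> f C = cevian_trace C A B P)"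

definition M_map :: "pt \<Rightarrow> pt \<Rightarrow> pt \<Rightarrow> ext_pt \<Rightarrow> pt \<Rightarrow> pt" where
  "M_map A B C P = T_map A B C P \<circ> inv (compl_map A B C) \<circ> T_map A B C (isotomic A B C P)"

definition is_translation :: "(pt \<Rightarrow> pt) \<Rightarrow> bool" where
  "is_translation f \<longleftrightarrow> (\<exists>t. f = (\<lambda>X. X + t))"

section \<open>Plane curves over the rationals\<close>

text \<open>
  A plane curve over \<open>\<rat>\<close> is given by a form with rational coefficients, regarded as a function on
  \<^typ>\<open>complex^3\<close>. Nonsingularity and ``all but finitely many points'' refer to the complex points,
  while curves and rational maps are defined over \<open>\<rat>\<close>. A vanishing (real) total derivative
  of a form means that all three complex partial derivatives vanish.
\<close>

definition rational_form :: "nat \<Rightarrow> (complex^3 \<Rightarrow> complex) \<Rightarrow> bool" where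
  "rational_form d F \<longleftrightarrow> (\<exists>c :: nat \<Rightarrow> nat \<Rightarrow> rat. \<forall>p.
     F p = (\<Sum>i\<le>d. \<Sum>j\<le>d - i. of_rat (c i j) * p$1 ^ i * p$2 ^ j * p$3 ^ (d - i - j)))"

definition same_point :: "complex^3 \<Rightarrow> complex^3 \<Rightarrow> bool" where
  "same_point p q \<longleftrightarrow> (\<exists>c. c \<noteq> 0 \<and> q = c *s p)"

definition on_curve :: "(complex^3 \<Rightarrow> complex) \<Rightarrow> complex^3 \<Rightarrow> bool" where
  "on_curve F p \<longleftrightarrow> p \<noteq> 0 \<and> F p = 0"

definition nonsingular_curve :: "(complex^3 \<Rightarrow> complex) \<Rightarrow> bool" where
  "nonsingular_curve F \<longleftrightarrow> (\<forall>p. on_curve F p \<longrightarrow> \<not> (F has_derivative (\<lambda>_. 0)) (at p))"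

definition elliptic_curve :: "(complex^3 \<Rightarrow> complex) \<Rightarrow> bool" where
  "elliptic_curve F \<longleftrightarrow> rational_form 3 F \<and> nonsingular_curve F \<and>
     (\<exists>p. on_curve F p \<and> (\<forall>i. p$i \<in> \<rat>))"

text \<open>
  A rational map to the projective plane is a triple of forms of the same degree, and \<open>\<psi>\<close> is a
  left inverse of \<open>\<phi>\<close> if \<open>\<psi> \<circ> \<phi>\<close> is defined and the identity at all but finitely many points.
\<close>

definition rational_map :: "(complex^3 \<Rightarrow> complex^3) \<Rightarrow> bool" where
  "rational_map \<phi> \<longleftrightarrow> (\<exists>d. \<forall>i. rational_form d (\<lambda>p. \<phi> p $ i))"

definition maps_with_left_inverse ::
  "(complex^3 \<Rightarrow> complex) \<Rightarrow> (complex^3 \<Rightarrow> complex) \<Rightarrow>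
   (complex^3 \<Rightarrow> complex^3) \<Rightarrow> (complex^3 \<Rightarrow> complex^3) \<Rightarrow> bool" where
  "maps_with_left_inverse F G \<phi> \<psi> \<longleftrightarrow> (\<exists>S. finite S \<and>
     (\<forall>p. on_curve F p \<longrightarrow> (\<forall>s\<in>S. \<not> same_point s p) \<longrightarrow>
        on_curve G (\<phi> p) \<and> same_point p (\<psi> (\<phi> p))))"

definition birationally_equivalent ::
  "(complex^3 \<Rightarrow> complex) \<Rightarrow> (complex^3 \<Rightarrow> complex) \<Rightarrow> bool" where
  "birationally_equivalent F G \<longleftrightarrow> (\<exists>\<phi> \<psi>. rational_map \<phi> \<and> rational_map \<psi> \<and>
     maps_with_left_inverse F G \<phi> \<psi> \<and> maps_with_left_inverse G F \<psi> \<phi>)"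

text \<open>
  The projective closure of
  \<open>y\<^sup>2 + a1 x y + a3 y = x\<^sup>3 + a2 x\<^sup>2 + a4 x + a6\<close>, with the usual quantities
  \<open>b2, b4, b6, b8, c4, \<Delta>\<close> and \<open>j = c4\<^sup>3 / \<Delta>\<close>.
\<close>

definition weierstrass_form ::
  "rat \<Rightarrow> rat \<Rightarrow> rat \<Rightarrow> rat \<Rightarrow> rat \<Rightarrow> complex^3 \<Rightarrow> complex" where
  "weierstrass_form a1 a2 a3 a4 a6 p = (let x = p$1; y = p$2; z = p$3 in
     y^2 * z + of_rat a1 * x * y * z + of_rat a3 * y * z^2
     - (x^3 + of_rat a2 * x^2 * z + of_rat a4 * x * z^2 + of_rat a6 * z^3))"

definition weierstrass_c4 :: "rat \<Rightarrow> rat \<Rightarrow> rat \<Rightarrow> rat \<Rightarrow> rat \<Rightarrow> rat" where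
  "weierstrass_c4 a1 a2 a3 a4 a6 =
     (let b2 = a1^2 + 4 * a2; b4 = 2 * a4 + a1 * a3 in b2^2 - 24 * b4)"

definition weierstrass_disc :: "rat \<Rightarrow> rat \<Rightarrow> rat \<Rightarrow> rat \<Rightarrow> rat \<Rightarrow> rat" where
  "weierstrass_disc a1 a2 a3 a4 a6 =
     (let b2 = a1^2 + 4 * a2; b4 = 2 * a4 + a1 * a3; b6 = a3^2 + 4 * a6;
          b8 = a1^2 * a6 + 4 * a2 * a6 - a1 * a3 * a4 + a2 * a3^2 - a4^2
      in - (b2^2 * b8) - 8 * b4^3 - 27 * b6^2 + 9 * b2 * b4 * b6)"

text \<open>
  The j-invariant of an elliptic curve is that of any of its Weierstrass models. It is stated as a
  relation; it is single-valued, since birationally equivalent nonsingular Weierstrass cubics have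
  the same j-invariant.
\<close>

definition has_j_invariant :: "(complex^3 \<Rightarrow> complex) \<Rightarrow> rat \<Rightarrow> bool" where
  "has_j_invariant F j \<longleftrightarrow> (\<exists>a1 a2 a3 a4 a6.
     birationally_equivalent F (weierstrass_form a1 a2 a3 a4 a6) \<and>
     weierstrass_disc a1 a2 a3 a4 a6 \<noteq> 0 \<and>
     j = weierstrass_c4 a1 a2 a3 a4 a6 ^ 3 / weierstrass_disc a1 a2 a3 a4 a6)"

section \<open>The two curves\<close>

definition E_S :: "('a::comm_ring_1)^3 \<Rightarrow> 'a" where
  "E_S p = (let x = p$1; y = p$2; z = p$3 in
     x * (y + z)^2 + y * (x + z)^2 + z * (x + y)^2)"

text \<open>The projective closure of \<open>v\<^sup>2 = u (u\<^sup>2 + 6 u - 3)\<close>.\<close>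

definition W_S :: "complex^3 \<Rightarrow> complex" where
  "W_S p = (let u = p$1; v = p$2; w = p$3 in
     v^2 * w - u * (u^2 + 6 * u * w - 3 * w^2))"

end

theory Submission
  imports Defs
begin

text \<open>
  The locus is found by computing \<open>M\<close> in barycentric coordinates, and the statements about the cubic
  hold because \<open>E_S\<close> is projectively equivalent over \<open>\<rat>\<close> to \<open>W_S\<close>.

  For \<open>P = (x, y, z)\<close>, membership in one of the six forbidden lines means
  \<open>xyz(y + z)(z + x)(x + y) = 0\<close>. Off these lines all cevian traces are ordinary points with explicit
  barycentric coordinates, and the linear parts of \<open>T\<^sub>P\<close> and \<open>T\<^sub>P\<^sub>'\<close> become explicit
  \<open>2 \<times> 2\<close> matrices in the basis \<open>B - A, C - A\<close>. Their product is the scalar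
  \<open>2xyz / ((x + y)(y + z)(z + x))\<close>; the linear part of \<open>K\<^sup>-\<^sup>1\<close> is \<open>-2\<close>, so \<open>M\<close> is a homothety or
  translation with ratio \<open>-4xyz / ((x + y)(y + z)(z + x))\<close> (lemma \<open>M_map_bary_vec\<close>). This ratio is 1
  exactly when \<open>(x + y)(y + z)(z + x) + 4xyz = 0\<close>, and the left-hand side is the form \<open>E_S\<close>.
  Written this way the form also shows where the curve meets the six lines: on it \<open>xyz\<close>
  and \<open>(x + y)(y + z)(z + x)\<close> vanish together, which leaves the three vertices and the three points
  at infinity of the sides (lemma \<open>E_S_exceptional\<close>).

  The rational point \<open>(0, 1, -1)\<close> is a flex of \<open>E_S\<close> with tangent
  \<open>4x + y + z = 0\<close>. A suitable linear change of coordinates sending this flex to \<open>(0, 1, 0)\<close> and its tangent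
  to the line at infinity brings a cubic into Weierstrass form. Here it turns \<open>E_S\<close> into \<open>W_S\<close>,
  up to a constant factor (lemma \<open>W_S_to_W\<close>); since it is invertible, it gives a birational
  equivalence without exceptional points. The \<open>j\<close>-invariant is read off from \<open>W_S\<close>.
\<close>

section \<open>Homogeneous barycentric coordinates\<close>

text \<open>
  A representative in \<^typ>\<open>(real^2) \<times> real\<close> of the point with the given barycentric coordinates.
  Keeping the three coordinates as separate arguments makes the cyclic symmetry of the triangle
  available by rewriting, so that each fact about a vertex is proved for \<open>A\<close> alone.
\<close>

definition bary_vec :: "pt \<Rightarrow> pt \<Rightarrow> pt \<Rightarrow> real \<Rightarrow> real \<Rightarrow> real \<Rightarrow> (real^2) \<times> real" where
  "bary_vec A B C x y z = x *\<^sub>R (A, 1) + y *\<^sub>R (B, 1) + z *\<^sub>R (C, 1)"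

lemma bary_eq_span: "bary A B C p = span {bary_vec A B C (p$1) (p$2) (p$3)}"
  by (simp add: bary_def bary_vec_def)

lemma bary_vector: "bary A B C (vector [x, y, z]) = span {bary_vec A B C x y z}"
  by (simp add: bary_eq_span vector_3)

lemma bary_vec_rotate: "bary_vec A B C x y z = bary_vec B C A y z x"
  by (simp add: bary_vec_def)

lemma scale_bary_vec: "k *\<^sub>R bary_vec A B C x y z = bary_vec A B C (k * x) (k * y) (k * z)"
  by (simp add: bary_vec_def algebra_simps)

lemma diff_bary_vec:
  "bary_vec A B C x y z - bary_vec A B C x' y' z' = bary_vec A B C (x - x') (y - y') (z - z')"
  by (simp add: bary_vec_def algebra_simps)

lemma noncollinear_rotate:
  "\<not> collinear {A, B, C} \<Longrightarrow> \<not> collinear {B, C, A}"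
  by (simp add: insert_commute)

lemma edges_independent:
  fixes A B C :: pt
  assumes "\<not> collinear {A, B, C}"
  shows "y *\<^sub>R (B - A) + z *\<^sub>R (C - A) = 0 \<longleftrightarrow> y = 0 \<and> z = 0"
proof
  assume eq: "y *\<^sub>R (B - A) + z *\<^sub>R (C - A) = 0"
  have ndep: "\<not> affine_dependent {A, B, C}" and dist: "A \<noteq> B" "A \<noteq> C" "B \<noteq> C"
    using assms by (auto simp: collinear_3_eq_affine_dependent)
  have "affine_dependent {A, B, C}" if "y \<noteq> 0 \<or> z \<noteq> 0"
    unfolding affine_dependent_explicit_finite[OF finite.insertI[OF finite.insertI[OF finite.insertI[OF finite.emptyI]]]]
    using that eq dist
    by (intro exI[of _ "\<lambda>X. if X = A then - y - z else if X = B then y else z"])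
       (auto simp: algebra_simps)
  then show "y = 0 \<and> z = 0" using ndep by blast
qed simp

lemma edges_basis:
  fixes A B C :: pt
  assumes "\<not> collinear {A, B, C}"
  shows "B - A \<noteq> C - A" and "independent {B - A, C - A}"
proof -
  note ind = edges_independent[OF assms]
  show ne: "B - A \<noteq> C - A"
    using ind[of 1 "-1"] by auto
  have "B - A \<notin> span {C - A}"
  proof
    assume "B - A \<in> span {C - A}"
    then obtain k where "B - A = k *\<^sub>R (C - A)" by (auto simp: span_singleton)
    then show False using ind[of 1 "-k"] by simp
  qed
  moreover have "C - A \<noteq> 0" using ind[of 0 1] by auto
  ultimately show "independent {B - A, C - A}"
    using ne by (simp add: independent_insert independent_empty)
qed

lemma mem_span_pair_iff:
  fixes v :: "'a::real_vector"
  shows "v \<in> span {a, b} \<longleftrightarrow> (\<exists>s t. v = s *\<^sub>R a + t *\<^sub>R b)"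
proof -
  have "v \<in> span {a, b} \<longleftrightarrow> (\<exists>s t. v - s *\<^sub>R a = t *\<^sub>R b)"
    by (auto simp: span_insert span_singleton)
  then show ?thesis by (simp add: diff_eq_eq add.commute)
qed

lemma edges_span:
  fixes A B C X :: pt
  assumes "\<not> collinear {A, B, C}"
  obtains y z where "X = y *\<^sub>R (B - A) + z *\<^sub>R (C - A)"
proof -
  have "dim (UNIV :: pt set) \<le> card {B - A, C - A}"
    using edges_basis(1)[OF assms] by simp
  then have "X \<in> span {B - A, C - A}"
    using card_ge_dim_independent[OF subset_UNIV edges_basis(2)[OF assms]] by auto
  then show thesis using that unfolding mem_span_pair_iff by blast
qed

lemma bary_vec_eq_0_iff:
  assumes "\<not> collinear {A, B, C}"
  shows "bary_vec A B C x y z = 0 \<longleftrightarrow> x = 0 \<and> y = 0 \<and> z = 0"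
proof
  assume "bary_vec A B C x y z = 0"
  then have "x *\<^sub>R A + y *\<^sub>R B + z *\<^sub>R C = 0" and s: "x = - y - z"
    by (auto simp: bary_vec_def zero_prod_def)
  then have "y *\<^sub>R (B - A) + z *\<^sub>R (C - A) = 0"
    by (simp add: algebra_simps)
  then show "x = 0 \<and> y = 0 \<and> z = 0" using edges_independent[OF assms] s by simp
qed (simp add: bary_vec_def zero_prod_def)

lemma bary_vec_eq_iff:
  assumes "\<not> collinear {A, B, C}"
  shows "bary_vec A B C x y z = bary_vec A B C x' y' z' \<longleftrightarrow> x = x' \<and> y = y' \<and> z = z'"
  using bary_vec_eq_0_iff[OF assms, of "x - x'" "y - y'" "z - z'"]
  by (simp flip: diff_bary_vec)

lemma bary_vec_exhaust:
  assumes "\<not> collinear {A, B, C}"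
  obtains x y z where "v = bary_vec A B C x y z"
proof -
  obtain X t where v: "v = (X, t)" by (cases v)
  obtain y z where "X - t *\<^sub>R A = y *\<^sub>R (B - A) + z *\<^sub>R (C - A)"
    using edges_span[OF assms] by metis
  then have "v = bary_vec A B C (t - y - z) y z"
    using v by (simp add: bary_vec_def algebra_simps)
  then show thesis by (rule that)
qed

lemma span_bary_vec_eq_iff:
  assumes "\<not> collinear {A, B, C}"
  shows "span {bary_vec A B C x y z} = span {bary_vec A B C x' y' z'}
    \<longleftrightarrow> (\<exists>k. k \<noteq> 0 \<and> x = k * x' \<and> y = k * y' \<and> z = k * z')"
    (is "?l \<longleftrightarrow> ?r")
proof
  assume l: ?l
  then have "bary_vec A B C x y z \<in> span {bary_vec A B C x' y' z'}"
    using span_base by blast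
  then obtain k where "bary_vec A B C x y z = bary_vec A B C (k * x') (k * y') (k * z')"
    by (auto simp: span_singleton scale_bary_vec)
  then have k: "x = k * x'" "y = k * y'" "z = k * z'"
    by (simp_all add: bary_vec_eq_iff[OF assms])
  have "bary_vec A B C x' y' z' \<in> span {bary_vec A B C x y z}"
    using l span_base by blast
  then obtain k' where "bary_vec A B C x' y' z' = bary_vec A B C (k' * x) (k' * y) (k' * z)"
    by (auto simp: span_singleton scale_bary_vec)
  then have k': "x' = k' * x" "y' = k' * y" "z' = k' * z"
    by (simp_all add: bary_vec_eq_iff[OF assms])
  show ?r
    using k k' by (cases "k = 0") (auto intro: exI[of _ 1])
next
  assume ?r
  then obtain k where "k \<noteq> 0" "bary_vec A B C x y z = k *\<^sub>R bary_vec A B C x' y' z'"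
    by (auto simp: scale_bary_vec)
  then show ?l
    using span_image_scale[of "{bary_vec A B C x' y' z'}" "\<lambda>_. k"] by simp
qed

lemma ord_inject:
  assumes "ord X = ord Y"
  shows "X = Y"
proof -
  have "(X, 1) \<in> span {(Y, 1 :: real)}"
    using assms span_base[of "(X, 1)" "{(X, 1)}"] by (auto simp: ord_def)
  then show ?thesis by (auto simp: span_singleton)
qed

lemma join_span: "join (span {v}) (span {w}) = span {v, w}"
proof -
  have "span (span {v} \<union> span {w}) = span ({v} \<union> {w})"
    by (simp only: span_Un span_span)
  then show ?thesis by (simp add: join_def insert_commute)
qed

lemma mem_join_iff: "v \<in> join (span {a}) (span {b}) \<longleftrightarrow> (\<exists>s t. v = s *\<^sub>R a + t *\<^sub>R b)"
  by (simp only: join_span mem_span_pair_iff)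

lemma span_singleton_subset_join:
  "span {v} \<subseteq> join (ord X) (ord Y) \<longleftrightarrow> (\<exists>s t. v = s *\<^sub>R (X, 1) + t *\<^sub>R (Y, 1))"
proof -
  have "span {v} \<subseteq> join (ord X) (ord Y) \<longleftrightarrow> v \<in> join (ord X) (ord Y)"
    unfolding ord_def join_span
    by (meson empty_subsetI insert_subset span_base span_minimal subspace_span insertI1 subsetD)
  then show ?thesis unfolding ord_def mem_join_iff .
qed

lemma on_line_iff:
  assumes "\<not> collinear {A, B, C}"
  shows "span {bary_vec A B C x y z} \<subseteq> join (ord B) (ord C) \<longleftrightarrow> x = 0"
proof -
  have "s *\<^sub>R (B, 1) + t *\<^sub>R (C, 1) = bary_vec A B C 0 s t" for s t
    by (simp add: bary_vec_def)
  then show ?thesis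
    by (auto simp: span_singleton_subset_join bary_vec_eq_iff[OF assms])
qed

text \<open>
  \<open>C + A - B\<close> and \<open>A + B - C\<close> are the images of \<open>B\<close> and \<open>C\<close> under \<open>K\<^sup>-\<^sup>1\<close>; the side joining them is
  the parallel to \<open>BC\<close> through \<open>A\<close>.
\<close>

lemma on_parallel_iff:
  assumes "\<not> collinear {A, B, C}"
  shows "span {bary_vec A B C x y z} \<subseteq> join (ord (C + A - B)) (ord (A + B - C)) \<longleftrightarrow> y + z = 0"
proof -
  have "s *\<^sub>R (C + A - B, 1) + t *\<^sub>R (A + B - C, 1) = bary_vec A B C (s + t) (t - s) (s - t)" for s t
    by (simp add: bary_vec_def algebra_simps)
  then have "span {bary_vec A B C x y z} \<subseteq> join (ord (C + A - B)) (ord (A + B - C))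
      \<longleftrightarrow> (\<exists>s t. x = s + t \<and> y = t - s \<and> z = s - t)"
    by (auto simp: span_singleton_subset_join bary_vec_eq_iff[OF assms])
  also have "\<dots> \<longleftrightarrow> y + z = 0"
  proof
    assume "y + z = 0"
    then have "x = (x - y) / 2 + (x + y) / 2 \<and> y = (x + y) / 2 - (x - y) / 2
        \<and> z = (x - y) / 2 - (x + y) / 2"
      by (simp add: field_simps)
    then show "\<exists>s t. x = s + t \<and> y = t - s \<and> z = s - t" by blast
  qed auto
  finally show ?thesis .
qed

lemma on_sides_iff:
  assumes "\<not> collinear {A, B, C}"
  shows "on_sides A B C (span {bary_vec A B C x y z}) \<longleftrightarrow> x = 0 \<or> y = 0 \<or> z = 0"
proof -
  note B = noncollinear_rotate[OF assms]
  note C = noncollinear_rotate[OF B]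
  show ?thesis
    unfolding on_sides_def
    using on_line_iff[OF assms, of x y z] on_line_iff[OF B, of y z x] on_line_iff[OF C, of z x y]
    by (simp add: bary_vec_rotate[of A B C x y z] bary_vec_rotate[of B C A y z x])
qed

lemma inv_compl_map: "inv (compl_map A B C) X = A + B + C - 2 *\<^sub>R X"
proof -
  have "inj (compl_map A B C)"
    by (auto simp: inj_def compl_map_def homothety_def)
  moreover have "compl_map A B C (A + B + C - 2 *\<^sub>R X) = X"
    by (simp add: compl_map_def homothety_def centroid_def vec_eq_iff field_simps)
  ultimately show ?thesis by (metis inv_f_f)
qed

lemma on_anticomplementary_sides_iff:
  assumes "\<not> collinear {A, B, C}"
  shows "on_sides (inv (compl_map A B C) A) (inv (compl_map A B C) B) (inv (compl_map A B C) C)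
           (span {bary_vec A B C x y z}) \<longleftrightarrow> y + z = 0 \<or> z + x = 0 \<or> x + y = 0"
proof -
  note B = noncollinear_rotate[OF assms]
  note C = noncollinear_rotate[OF B]
  have k: "inv (compl_map A B C) A = B + C - A" "inv (compl_map A B C) B = C + A - B"
      "inv (compl_map A B C) C = A + B - C"
    by (simp_all add: inv_compl_map scaleR_2)
  show ?thesis
    unfolding on_sides_def k
    using on_parallel_iff[OF assms, of x y z] on_parallel_iff[OF B, of y z x]
      on_parallel_iff[OF C, of z x y]
    by (simp add: bary_vec_rotate[of A B C x y z] bary_vec_rotate[of B C A y z x])
qed

section \<open>The maps in coordinates\<close>

text \<open>
  The vector \<open>(0, y, z)\<close> is the difference of \<open>(x, y, z)\<close> and a multiple of \<open>A\<close>, hence it spans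
  the intersection of the two lines; \<open>y + z \<noteq> 0\<close> allows normalizing it to an ordinary point.
\<close>

lemma cevian_trace_bary_vec:
  assumes nc: "\<not> collinear {A, B, C}" and x: "x \<noteq> 0" and yz: "y + z \<noteq> 0"
  shows "cevian_trace A B C (span {bary_vec A B C x y z}) = (y / (y + z)) *\<^sub>R B + (z / (y + z)) *\<^sub>R C"
    (is "_ = ?D")
proof -
  have D: "(?D, 1) = bary_vec A B C 0 (y / (y + z)) (z / (y + z))"
    using yz by (simp add: bary_vec_def flip: add_divide_distrib)
  have "ord ?D = join (ord A) (span {bary_vec A B C x y z}) \<inter> join (ord B) (ord C)"
  proof (intro set_eqI iffI)
    fix v assume "v \<in> ord ?D"
    then obtain k where v: "v = bary_vec A B C 0 (k * (y / (y + z))) (k * (z / (y + z)))"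
      by (auto simp: ord_def D span_singleton scale_bary_vec)
    let ?k = "k / (y + z)"
    have "v = (- ?k * x) *\<^sub>R (A, 1) + ?k *\<^sub>R bary_vec A B C x y z"
      using yz by (simp add: v bary_vec_def field_simps)
    moreover have "v = (k * (y / (y + z))) *\<^sub>R (B, 1) + (k * (z / (y + z))) *\<^sub>R (C, 1)"
      by (simp add: v bary_vec_def)
    ultimately show "v \<in> join (ord A) (span {bary_vec A B C x y z}) \<inter> join (ord B) (ord C)"
      unfolding ord_def Int_iff mem_join_iff by blast
  next
    fix v assume "v \<in> join (ord A) (span {bary_vec A B C x y z}) \<inter> join (ord B) (ord C)"
    then obtain s t q r where 1: "v = s *\<^sub>R (A, 1) + t *\<^sub>R bary_vec A B C x y z"
        and 2: "v = q *\<^sub>R (B, 1) + r *\<^sub>R (C, 1)"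
      unfolding ord_def Int_iff mem_join_iff by blast
    have v: "v = bary_vec A B C 0 q r"
      unfolding 2 by (simp add: bary_vec_def)
    moreover have "v = bary_vec A B C (s + t * x) (t * y) (t * z)"
      unfolding 1 by (simp add: bary_vec_def algebra_simps)
    ultimately have "q = t * y" "r = t * z" using bary_vec_eq_iff[OF nc] by auto
    then have "v = (t * (y + z)) *\<^sub>R (?D, 1)"
      using v yz unfolding D scale_bary_vec by simp
    then show "v \<in> ord ?D"
      unfolding ord_def span_singleton by (rule range_eqI)
  qed
  then show ?thesis
    unfolding cevian_trace_def by (intro the_equality) (auto intro: ord_inject)
qed

lemma isotomic_bary_vec:
  assumes nc: "\<not> collinear {A, B, C}" and "x \<noteq> 0" "y \<noteq> 0" "z \<noteq> 0"
  shows "isotomic A B C (span {bary_vec A B C x y z}) = span {bary_vec A B C (1/x) (1/y) (1/z)}"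
  unfolding isotomic_def bary_vector
proof (rule the_equality)
  show "\<exists>x' y' z'. x' \<noteq> 0 \<and> y' \<noteq> 0 \<and> z' \<noteq> 0 \<and> span {bary_vec A B C x y z} = span {bary_vec A B C x' y' z'} \<and>
      span {bary_vec A B C (1/x) (1/y) (1/z)} = span {bary_vec A B C (1/x') (1/y') (1/z')}"
    using assms by blast
next
  fix Q
  assume "\<exists>x' y' z'. x' \<noteq> 0 \<and> y' \<noteq> 0 \<and> z' \<noteq> 0 \<and> span {bary_vec A B C x y z} = span {bary_vec A B C x' y' z'} \<and>
      Q = span {bary_vec A B C (1/x') (1/y') (1/z')}"
  then obtain x' y' z' where eq: "span {bary_vec A B C x y z} = span {bary_vec A B C x' y' z'}"
      and Q: "Q = span {bary_vec A B C (1/x') (1/y') (1/z')}" by blast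
  obtain k where "k \<noteq> 0" "x = k * x'" "y = k * y'" "z = k * z'"
    using eq unfolding span_bary_vec_eq_iff[OF nc] by blast
  then show "Q = span {bary_vec A B C (1/x) (1/y) (1/z)}"
    unfolding Q span_bary_vec_eq_iff[OF nc] by (intro exI[of _ k]) simp
qed

text \<open>
  This replaces the definite description of \<open>T_map\<close> by what the computation of \<open>M\<close> needs, namely the
  values of its linear part on the basis \<open>B - A, C - A\<close>.
\<close>

lemma T_map_affine:
  assumes nc: "\<not> collinear {A, B, C}"
  obtains g c where "linear g" "T_map A B C P = (\<lambda>X. g X + c)"
    "g (B - A) = cevian_trace B C A P - cevian_trace A B C P"
    "g (C - A) = cevian_trace C A B P - cevian_trace A B C P"
proof -
  let ?D = "cevian_trace A B C P" and ?E = "cevian_trace B C A P" and ?F = "cevian_trace C A B P"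
  let ?Q = "\<lambda>f. affine_map f \<and> f A = ?D \<and> f B = ?E \<and> f C = ?F"
  note ne = edges_basis(1)[OF nc]
  have "\<exists>!f. ?Q f"
  proof (rule ex_ex1I)
    obtain g where g: "linear g"
        "g (B - A) = ?E - ?D" "g (C - A) = ?F - ?D"
      using linear_independent_extend[OF edges_basis(2)[OF nc],
          of "\<lambda>X. if X = B - A then ?E - ?D else ?F - ?D"] ne
      by (metis insert_iff)
    then have "g B - g A = ?E - ?D" "g C - g A = ?F - ?D"
      by (metis linear_diff)+
    moreover have "affine_map (\<lambda>X. g X + (?D - g A))"
      using g(1) unfolding affine_map_def by blast
    ultimately have "?Q (\<lambda>X. g X + (?D - g A))"
      by (auto simp: algebra_simps)
    then show "\<exists>f. ?Q f" by blast
  next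
    fix f f' assume f: "?Q f" and f': "?Q f'"
    obtain g c where g: "linear g" "f = (\<lambda>X. g X + c)" using f by (auto simp: affine_map_def)
    obtain g' c' where g': "linear g'" "f' = (\<lambda>X. g' X + c')" using f' by (auto simp: affine_map_def)
    have U: "g (B - A) = g' (B - A)" and V: "g (C - A) = g' (C - A)"
      using f f' unfolding linear_diff[OF g(1)] linear_diff[OF g'(1)] g(2) g'(2)
      by (metis add_diff_cancel_right)+
    have "g X = g' X" for X
    proof -
      obtain q r where "X = q *\<^sub>R (B - A) + r *\<^sub>R (C - A)"
        using edges_span[OF nc] .
      then show ?thesis
        by (simp only: linear_add[OF g(1)] linear_add[OF g'(1)] linear_scale[OF g(1)]
            linear_scale[OF g'(1)] U V)
    qed
    then have "g = g'" by blast
    moreover from this have "c = c'" using f f' unfolding g(2) g'(2) by (metis add_left_cancel)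
    ultimately show "f = f'" unfolding g(2) g'(2) by simp
  qed
  then have Q: "?Q (T_map A B C P)" unfolding T_map_def by (rule theI')
  then obtain g c where g: "linear g" "T_map A B C P = (\<lambda>X. g X + c)"
    unfolding affine_map_def by blast
  show thesis
  proof (rule that[OF g])
    show "g (B - A) = ?E - ?D" "g (C - A) = ?F - ?D"
      using Q unfolding linear_diff[OF g(1)] g(2) by (metis add_diff_cancel_right)+
  qed
qed

text \<open>
  The linear parts \<open>g\<close> and \<open>g'\<close> of \<open>T\<^sub>P\<close> and \<open>T\<^sub>P\<^sub>'\<close> are matrices in the basis \<open>U = B - A\<close>,
  \<open>V = C - A\<close>. The isotomic conjugate swaps the weights at the two ends of each side; as the
  weights on a side sum to 1, the off-diagonal entries of \<open>g g'\<close> cancel.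
\<close>

lemma M_map_bary_vec:
  assumes nc: "\<not> collinear {A, B, C}" and nz: "x \<noteq> 0" "y \<noteq> 0" "z \<noteq> 0"
    and nz': "y + z \<noteq> 0" "z + x \<noteq> 0" "x + y \<noteq> 0"
  obtains t where
    "M_map A B C (span {bary_vec A B C x y z})
       = (\<lambda>X. (- 4 * x * y * z / ((x + y) * (y + z) * (z + x))) *\<^sub>R X + t)"
proof -
  define a b c where "a = 1 / (y + z)" "b = 1 / (z + x)" "c = 1 / (x + y)"
  note B = noncollinear_rotate[OF nc]
  note C = noncollinear_rotate[OF B]
  let ?P = "span {bary_vec A B C x y z}" and ?P' = "span {bary_vec A B C (1/x) (1/y) (1/z)}"
  have D: "cevian_trace A B C ?P = (a * y) *\<^sub>R B + (a * z) *\<^sub>R C"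
    using cevian_trace_bary_vec[OF nc, of x y z] nz nz' by (simp add: a_b_c_def)
  have E: "cevian_trace B C A ?P = (b * z) *\<^sub>R C + (b * x) *\<^sub>R A"
    using cevian_trace_bary_vec[OF B, of y z x] nz nz' by (simp add: a_b_c_def bary_vec_rotate[of A B C])
  have F: "cevian_trace C A B ?P = (c * x) *\<^sub>R A + (c * y) *\<^sub>R B"
    using cevian_trace_bary_vec[OF C, of z x y] nz nz'
    by (simp add: a_b_c_def bary_vec_rotate[of A B C] bary_vec_rotate[of B C A])
  have inv: "1/r + 1/s \<noteq> 0" "(1/r) / (1/r + 1/s) = s / (r + s)" "(1/s) / (1/r + 1/s) = r / (r + s)"
    if "r \<noteq> 0" "s \<noteq> 0" "r + s \<noteq> 0" for r s :: real
    using that by (simp_all add: divide_simps add.commute)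
  have D': "cevian_trace A B C ?P' = (a * z) *\<^sub>R B + (a * y) *\<^sub>R C"
    using cevian_trace_bary_vec[OF nc, of "1/x" "1/y" "1/z"] nz nz' inv[of y z]
    by (simp add: a_b_c_def)
  have E': "cevian_trace B C A ?P' = (b * x) *\<^sub>R C + (b * z) *\<^sub>R A"
    using cevian_trace_bary_vec[OF B, of "1/y" "1/z" "1/x"] nz nz' inv[of z x]
    by (simp add: a_b_c_def bary_vec_rotate[of A B C])
  have F': "cevian_trace C A B ?P' = (c * y) *\<^sub>R A + (c * x) *\<^sub>R B"
    using cevian_trace_bary_vec[OF C, of "1/z" "1/x" "1/y"] nz nz' inv[of x y]
    by (simp add: a_b_c_def bary_vec_rotate[of A B C] bary_vec_rotate[of B C A])
  obtain g e where g: "linear g" "T_map A B C ?P = (\<lambda>X. g X + e)"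
      and gU: "g (B - A) = cevian_trace B C A ?P - cevian_trace A B C ?P"
      and gV: "g (C - A) = cevian_trace C A B ?P - cevian_trace A B C ?P"
    using T_map_affine[OF nc] .
  obtain g' e' where g': "linear g'" "T_map A B C ?P' = (\<lambda>X. g' X + e')"
      and g'U: "g' (B - A) = cevian_trace B C A ?P' - cevian_trace A B C ?P'"
      and g'V: "g' (C - A) = cevian_trace C A B ?P' - cevian_trace A B C ?P'"
    using T_map_affine[OF nc] .
  define U V where "U = B - A" "V = C - A"
  have BC: "B = A + U" "C = A + V" by (simp_all add: U_V_def)
  have sum: "a * y + a * z = 1" "b * z + b * x = 1" "c * x + c * y = 1"
    using nz' by (simp_all add: a_b_c_def flip: add_divide_distrib)
  then have s: "a * y = 1 - a * z" "b * z = 1 - b * x" "c * x = 1 - c * y" by auto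
  have gU: "g U = (- (a * y)) *\<^sub>R U + (b * z - a * z) *\<^sub>R V"
    using gU[unfolded E D] unfolding BC s by (simp add: algebra_simps)
  have gV: "g V = (c * y - a * y) *\<^sub>R U + (- (a * z)) *\<^sub>R V"
    using gV[unfolded F D] unfolding BC s by (simp add: algebra_simps)
  have g'U: "g' U = (- (a * z)) *\<^sub>R U + (b * x - a * y) *\<^sub>R V"
    using g'U[unfolded E' D'] unfolding BC s by (simp add: algebra_simps)
  have g'V: "g' V = (c * x - a * z) *\<^sub>R U + (- (a * y)) *\<^sub>R V"
    using g'V[unfolded F' D'] unfolding BC s by (simp add: algebra_simps)
  \<comment> \<open>\<open>m11\<close>, \<open>m12\<close>, \<open>m21\<close>, \<open>m22\<close> are the entries of the matrix of \<open>g g'\<close>.\<close>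
  define m where "m = 2 * x * y * z * (a * b * c)"
  have "a * (y + z) = 1" "b * (z + x) = 1" "c * (x + y) = 1"
    using sum by (simp_all add: algebra_simps)
  then have
    m11: "a * z * (a * y) + (b * x - a * y) * (c * y - a * y) = m" and
    m12: "- (a * z) * (b * z - a * z) - (b * x - a * y) * (a * z) = 0" and
    m21: "- (c * x - a * z) * (a * y) - a * y * (c * y - a * y) = 0" and
    m22: "(c * x - a * z) * (b * z - a * z) + a * y * (a * z) = m"
    unfolding m_def by algebra+
  have "g (g' U) = (a * z * (a * y) + (b * x - a * y) * (c * y - a * y)) *\<^sub>R U
      + (- (a * z) * (b * z - a * z) - (b * x - a * y) * (a * z)) *\<^sub>R V"
    unfolding g'U linear_add[OF g(1)] linear_scale[OF g(1)] gU gV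
    by (simp add: algebra_simps)
  then have ggU: "g (g' U) = m *\<^sub>R U" unfolding m11 m12 by simp
  have "g (g' V) = (- (c * x - a * z) * (a * y) - a * y * (c * y - a * y)) *\<^sub>R U
      + ((c * x - a * z) * (b * z - a * z) + a * y * (a * z)) *\<^sub>R V"
    unfolding g'V linear_add[OF g(1)] linear_scale[OF g(1)] gU gV
    by (simp add: algebra_simps)
  then have ggV: "g (g' V) = m *\<^sub>R V" unfolding m21 m22 by simp
  have gg: "g (g' X) = m *\<^sub>R X" for X
  proof -
    obtain q r where "X = q *\<^sub>R U + r *\<^sub>R V"
      using edges_span[OF nc] unfolding U_V_def by metis
    then show ?thesis
      by (simp add: linear_add[OF g(1)] linear_scale[OF g(1)] linear_add[OF g'(1)]
          linear_scale[OF g'(1)] ggU ggV scaleR_add_right mult.commute)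
  qed
  have "M_map A B C ?P X = (- 2 * m) *\<^sub>R X + (g (A + B + C) - 2 *\<^sub>R g e' + e)" for X
    unfolding M_map_def isotomic_bary_vec[OF nc nz] o_def g g' inv_compl_map
    by (simp add: linear_diff[OF g(1)] linear_add[OF g(1)] linear_scale[OF g(1)] gg scaleR_add_right)
  moreover have "- 2 * m = - 4 * x * y * z / ((x + y) * (y + z) * (z + x))"
    by (simp add: m_def a_b_c_def mult_ac)
  ultimately show thesis using that by (metis ext)
qed

lemma is_translation_homothety_iff:
  "is_translation (\<lambda>X. k *\<^sub>R X + t) \<longleftrightarrow> k = 1"
proof
  assume "is_translation (\<lambda>X. k *\<^sub>R X + t)"
  then obtain t' where eq: "k *\<^sub>R X + t = X + t'" for X
    unfolding is_translation_def by metis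
  have "k *\<^sub>R vec 1 = (vec 1 :: pt)"
    using eq[of 0] eq[of "vec 1"] by simp
  then show "k = 1" by (simp add: vec_eq_iff)
qed (auto simp: is_translation_def)

lemma translation_iff_E_S:
  assumes nc: "\<not> collinear {A, B, C}" and nz: "x \<noteq> 0" "y \<noteq> 0" "z \<noteq> 0"
    and nz': "y + z \<noteq> 0" "z + x \<noteq> 0" "x + y \<noteq> 0"
  shows "is_translation (M_map A B C (span {bary_vec A B C x y z})) \<longleftrightarrow> E_S (vector [x, y, z]) = 0"
proof -
  obtain t where t: "M_map A B C (span {bary_vec A B C x y z})
       = (\<lambda>X. (- 4 * x * y * z / ((x + y) * (y + z) * (z + x))) *\<^sub>R X + t)"
    using M_map_bary_vec[OF assms] .
  have "(x + y) * (y + z) * (z + x) \<noteq> 0" using nz' by simp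
  then have "- 4 * x * y * z / ((x + y) * (y + z) * (z + x)) = 1 
      \<longleftrightarrow> - 4 * x * y * z = (x + y) * (y + z) * (z + x)"
    by (simp add: divide_eq_eq, linarith)
  also have "\<dots> \<longleftrightarrow> E_S (vector [x, y, z]) = 0"
    by (auto simp: E_S_def Let_def vector_3 power2_eq_square algebra_simps)
  finally show ?thesis unfolding t is_translation_homothety_iff .
qed

text \<open>
  On the curve \<open>(x + y)(y + z)(z + x) = -4xyz\<close>. Hence a point of it on one of the six lines lies
  on a side and also on a side of the anticomplementary triangle.
\<close>

lemma E_S_exceptional:
  fixes x y z :: real
  assumes E: "E_S (vector [x, y, z]) = 0"
  shows "x * y * z * (y + z) * (z + x) * (x + y) = 0 \<longleftrightarrow>
    (y = 0 \<and> z = 0) \<or> (z = 0 \<and> x = 0) \<or> (x = 0 \<and> y = 0) \<or>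
    (x = 0 \<and> y + z = 0) \<or> (y = 0 \<and> z + x = 0) \<or> (z = 0 \<and> x + y = 0)"
proof -
  have E: "(x + y) * (y + z) * (z + x) + 4 * x * y * z = 0"
    using E by (simp add: E_S_def Let_def vector_3 power2_eq_square algebra_simps)
  then have "x * y * z = 0 \<longleftrightarrow> (x + y) * (y + z) * (z + x) = 0" by auto
  then show ?thesis by auto
qed

theorem translation_locus:
  assumes nc: "\<not> collinear {A, B, C}"
  shows "{P \<in> ext_plane. \<not> on_sides A B C P \<and>
            \<not> on_sides (inv (compl_map A B C) A) (inv (compl_map A B C) B)
                        (inv (compl_map A B C) C) P \<and>
            is_translation (M_map A B C P)}
         = {bary A B C p | p. p \<noteq> 0 \<and> E_S p = 0}
           - {ord A, ord B, ord C,
              bary A B C (vector [0, 1, -1]),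
              bary A B C (vector [1, 0, -1]),
              bary A B C (vector [1, -1, 0])}"
    (is "?L = ?R - ?S")
proof -
  have ordA: "ord A = span {bary_vec A B C 1 0 0}" and ordB: "ord B = span {bary_vec A B C 0 1 0}"
    and ordC: "ord C = span {bary_vec A B C 0 0 1}"
    by (simp_all add: ord_def bary_vec_def)
  have vec: "vector [p$1, p$2, p$3] = p" for p :: "real^3"
    by (simp add: vec_eq_iff forall_3 vector_3)
  have L: "span {bary_vec A B C x y z} \<in> ?L \<longleftrightarrow>
      x * y * z * (y + z) * (z + x) * (x + y) \<noteq> 0 \<and> E_S (vector [x, y, z]) = 0" for x y z
  proof (cases "x * y * z * (y + z) * (z + x) * (x + y) = 0")
    case True
    then show ?thesis using on_sides_iff[OF nc] on_anticomplementary_sides_iff[OF nc] by auto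
  next
    case False
    then have "bary_vec A B C x y z \<noteq> 0" using bary_vec_eq_0_iff[OF nc] by auto
    then have "span {bary_vec A B C x y z} \<in> ext_plane" unfolding ext_plane_def by blast
    then show ?thesis
      using False on_sides_iff[OF nc] on_anticomplementary_sides_iff[OF nc]
        translation_iff_E_S[OF nc, of x y z] by auto
  qed
  have S: "span {bary_vec A B C x y z} \<in> ?S \<longleftrightarrow>
    (y = 0 \<and> z = 0) \<or> (z = 0 \<and> x = 0) \<or> (x = 0 \<and> y = 0) \<or>
    (x = 0 \<and> y + z = 0) \<or> (y = 0 \<and> z + x = 0) \<or> (z = 0 \<and> x + y = 0)"
    (is "_ \<longleftrightarrow> ?six") if "x \<noteq> 0 \<or> y \<noteq> 0 \<or> z \<noteq> 0" for x y z
    using that unfolding bary_vector ordA ordB ordC insert_iff empty_iff span_bary_vec_eq_iff[OF nc]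
    by (auto simp: add_eq_0_iff2)
  show ?thesis
  proof (intro subset_antisym subsetI)
    fix P assume P: "P \<in> ?L"
    then obtain v where "P = span {v}" by (auto simp: ext_plane_def)
    then obtain x y z where Pc: "P = span {bary_vec A B C x y z}"
      using bary_vec_exhaust[OF nc] by metis
    have nz: "x * y * z * (y + z) * (z + x) * (x + y) \<noteq> 0" and E: "E_S (vector [x, y, z]) = 0"
      using P unfolding Pc L by auto
    have "(vector [x, y, z] :: real^3) \<noteq> 0"
      using nz by (auto simp: vec_eq_iff forall_3 vector_3)
    then have "P \<in> ?R" using E Pc bary_vector by blast
    moreover have nz': "x \<noteq> 0 \<or> y \<noteq> 0 \<or> z \<noteq> 0" using nz by simp
    have "P \<notin> ?S"
      using nz unfolding E_S_exceptional[OF E] Pc S[OF nz'] .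
    ultimately show "P \<in> ?R - ?S" by blast
  next
    fix P assume P: "P \<in> ?R - ?S"
    then obtain p where p: "P = bary A B C p" "p \<noteq> 0" "E_S p = 0" by blast
    obtain x y z where xyz: "p = vector [x, y, z]" using vec by metis
    have nz: "x \<noteq> 0 \<or> y \<noteq> 0 \<or> z \<noteq> 0"
      using p(2) unfolding xyz by (auto simp: vec_eq_iff forall_3 vector_3)
    have Pc: "P = span {bary_vec A B C x y z}" using p(1) xyz bary_vector by simp
    have E: "E_S (vector [x, y, z]) = 0" using p(3) xyz by simp
    have "P \<notin> ?S" using P by blast
    then have "x * y * z * (y + z) * (z + x) * (x + y) \<noteq> 0"
      unfolding E_S_exceptional[OF E] unfolding Pc S[OF nz] .
    with E show "P \<in> ?L" unfolding Pc L by (rule conjI[rotated])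
  qed
qed

section \<open>The cubic\<close>

lemma E_S_form: "E_S p = (let x = p$1; y = p$2; z = p$3 in
    x^2*y + x^2*z + x*y^2 + y^2*z + x*z^2 + y*z^2 + 6*x*y*z)"
  by (simp add: E_S_def Let_def power2_eq_square algebra_simps)

lemma rational_form_E_S: "rational_form 3 E_S"
  unfolding rational_form_def
proof (intro exI allI)
  fix p :: "complex^3"
  let ?c = "\<lambda>i j. if (i, j) = (1, 1) then 6
     else if (i, j) \<in> {(2, 1), (2, 0), (1, 2), (0, 2), (1, 0), (0, 1)} then 1 else (0 :: rat)"
  show "E_S p = (\<Sum>i\<le>3. \<Sum>j\<le>3 - i. of_rat (?c i j) * p$1 ^ i * p$2 ^ j * p$3 ^ (3 - i - j))"
    by (simp add: E_S_form Let_def numeral_3_eq_3 numeral_2_eq_2 algebra_simps)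
qed

lemma E_S_has_derivative:
  fixes p :: "complex^3"
  shows "(E_S has_derivative (\<lambda>h.
      (2*p$1*(p$2 + p$3) + (p$2)^2 + (p$3)^2 + 6*p$2*p$3) * h$1
    + (2*p$2*(p$3 + p$1) + (p$3)^2 + (p$1)^2 + 6*p$3*p$1) * h$2
    + (2*p$3*(p$1 + p$2) + (p$1)^2 + (p$2)^2 + 6*p$1*p$2) * h$3)) (at p)"
proof -
  have nth: "((\<lambda>q. q $ i) has_derivative (\<lambda>h. h $ i)) (at p)" for i :: 3
    by (rule bounded_linear_imp_has_derivative) (rule bounded_linear_vec_nth)
  show ?thesis
    unfolding E_S_def Let_def
    by (rule has_derivative_eq_rhs, (rule derivative_intros nth)+)
       (simp add: fun_eq_iff power2_eq_square algebra_simps)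
qed

text \<open>
  Differences of the partial derivatives factor, for instance
  \<open>(y - x)(x + y + 4z)\<close>. If no two coordinates of a singular point agreed, the three linear cofactors
  would vanish, which forces \<open>x = y\<close>; so two coordinates agree, and then the third is
  either equal to them or \<open>-5\<close> times their value, and the partial derivatives leave only 0.
\<close>

lemma E_S_nonsingular: "nonsingular_curve E_S"
  unfolding nonsingular_curve_def
proof (intro allI impI notI)
  fix p :: "complex^3"
  assume p: "on_curve E_S p" and d: "(E_S has_derivative (\<lambda>_. 0)) (at p)"
  obtain x y z where xyz: "p$1 = x" "p$2 = y" "p$3 = z" by blast
  have eq: "(2*x*(y + z) + y^2 + z^2 + 6*y*z) * h$1 + (2*y*(z + x) + z^2 + x^2 + 6*z*x) * h$2
    + (2*z*(x + y) + x^2 + y^2 + 6*x*y) * h$3 = 0" for h :: "complex^3"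
    using has_derivative_unique[OF E_S_has_derivative d] unfolding xyz by metis
  have dx: "2*x*(y + z) + y^2 + z^2 + 6*y*z = 0"
    and dy: "2*y*(z + x) + z^2 + x^2 + 6*z*x = 0"
    and dz: "2*z*(x + y) + x^2 + y^2 + 6*x*y = 0"
    using eq[of "vector [1, 0, 0]"] eq[of "vector [0, 1, 0]"] eq[of "vector [0, 0, 1]"]
    by (simp_all add: vector_3)
  have 12: "(y - x) * (x + y + 4*z) = 0" and 23: "(z - y) * (y + z + 4*x) = 0"
    and 31: "(x - z) * (z + x + 4*y) = 0"
    using dx dy dz by algebra+
  have "x = 0 \<and> y = 0 \<and> z = 0"
  proof -
    have two: "r = 0 \<and> s = 0" if e: "(s - r) * (r + s + 4*r) = 0"
        "2*r*(r + s) + r^2 + s^2 + 6 * r * s = 0" for r s :: complex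
    proof -
      have "(s - r) * (s + 5 * r) = 0" using e(1) by (simp add: algebra_simps)
      then consider "s = r" | "s = - 5 * r" by (auto simp: add_eq_0_iff2)
      then show ?thesis
        by cases (use e(2) in \<open>auto simp: power2_eq_square algebra_simps\<close>)
    qed
    consider "x = y" | "y = z" | "z = x" | "x + y + 4*z = 0" "y + z + 4*x = 0" "z + x + 4*y = 0" "x \<noteq> y"
      using 12 23 31 by auto
    then show ?thesis
    proof cases
      case 1 then show ?thesis using two[where r = x and s = z] 23 dx by (auto simp: algebra_simps)
    next
      case 2 then show ?thesis using two[where r = y and s = x] 31 dy by (auto simp: algebra_simps)
    next
      case 3 then show ?thesis using two[where r = z and s = y] 12 dz by (auto simp: algebra_simps)
    next
      case 4
      then have "x = y" by algebra
      then show ?thesis using 4 by simp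
    qed
  qed
  then have "p = 0" using xyz by (simp add: vec_eq_iff forall_3)
  then show False using p by (simp add: on_curve_def)
qed

lemma elliptic_curve_E_S: "elliptic_curve E_S"
  unfolding elliptic_curve_def
proof (intro conjI exI rational_form_E_S E_S_nonsingular)
  let ?p = "vector [1, 0, 0] :: complex^3"
  show "on_curve E_S ?p"
    by (auto simp: on_curve_def E_S_def Let_def vector_3 vec_eq_iff forall_3)
  show "\<forall>i. ?p $ i \<in> \<rat>" by (simp add: forall_3 vector_3)
qed

lemma rational_form_linear:
  "rational_form 1 (\<lambda>p. of_rat a * p$1 + of_rat b * p$2 + of_rat c * p$3)"
  unfolding rational_form_def
  by (intro exI[of _ "\<lambda>i j. if i = 1 then a else if j = 1 then b else c"])
     (simp add: algebra_simps)

text \<open>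
  The third coordinate vanishes on the tangent at the flex \<open>(0, 1, -1)\<close>. The symmetry swapping
  \<open>y\<close> and \<open>z\<close> fixes the flex and negates the second coordinate, which therefore enters the transformed
  cubic only squared. The first coordinate vanishes, like the second, at \<open>(1, 0, 0)\<close>, so that this
  point of order 2 goes to the origin of the affine curve. The factors \<open>-3\<close> and 6 normalize
  the leading coefficients.
\<close>

definition to_W :: "complex^3 \<Rightarrow> complex^3" where
  "to_W p = vector [- 3 * (p$2 + p$3), 6 * (p$2 - p$3), 4 * p$1 + p$2 + p$3]"

definition from_W :: "complex^3 \<Rightarrow> complex^3" where
  "from_W q = vector [q$1 / 12 + q$3 / 4, - (q$1 / 6) + q$2 / 12, - (q$1 / 6) - q$2 / 12]"

lemma from_to_W: "from_W (to_W p) = p" and to_from_W: "to_W (from_W q) = q"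
  by (simp_all add: vec_eq_iff forall_3 from_W_def to_W_def vector_3 field_simps)

lemma W_S_to_W: "W_S (to_W p) = - 144 * E_S p"
  by (simp add: W_S_def E_S_def to_W_def Let_def vector_3 power2_eq_square algebra_simps)

lemma rational_map_to_W: "rational_map to_W"
  unfolding rational_map_def forall_3
proof (intro exI conjI)
  show "rational_form 1 (\<lambda>p. to_W p $ 1)"
    using rational_form_linear[of 0 "-3" "-3"] by (simp add: to_W_def vector_3 algebra_simps)
  show "rational_form 1 (\<lambda>p. to_W p $ 2)"
    using rational_form_linear[of 0 6 "-6"] by (simp add: to_W_def vector_3 algebra_simps)
  show "rational_form 1 (\<lambda>p. to_W p $ 3)"
    using rational_form_linear[of 4 1 1] by (simp add: to_W_def vector_3 algebra_simps)
qed

lemma rational_map_from_W: "rational_map from_W"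
  unfolding rational_map_def forall_3
proof (intro exI conjI)
  show "rational_form 1 (\<lambda>p. from_W p $ 1)"
    using rational_form_linear[of "1/12" 0 "1/4"] by (simp add: from_W_def vector_3 of_rat_divide)
  show "rational_form 1 (\<lambda>p. from_W p $ 2)"
    using rational_form_linear[of "-1/6" "1/12" 0]
    by (simp add: from_W_def vector_3 of_rat_divide of_rat_minus)
  show "rational_form 1 (\<lambda>p. from_W p $ 3)"
    using rational_form_linear[of "-1/6" "-1/12" 0]
    by (simp add: from_W_def vector_3 of_rat_divide of_rat_minus)
qed

lemma birationally_equivalent_E_S_W_S: "birationally_equivalent E_S W_S"
  unfolding birationally_equivalent_def
proof (rule exI[of _ to_W], rule exI[of _ from_W], intro conjI)
  show "rational_map to_W" "rational_map from_W"
    by (fact rational_map_to_W rational_map_from_W)+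
next
  have refl: "same_point p p" for p by (auto simp: same_point_def intro: exI[of _ 1])
  have "to_W 0 = 0" "from_W 0 = 0"
    by (simp_all add: vec_eq_iff forall_3 from_W_def to_W_def vector_3)
  then have nz: "to_W p = 0 \<longleftrightarrow> p = 0" "from_W q = 0 \<longleftrightarrow> q = 0" for p q
    by (metis from_to_W to_from_W)+
  have E: "E_S (from_W q) = 0 \<longleftrightarrow> W_S q = 0" for q
    using W_S_to_W[of "from_W q"] by (simp add: to_from_W)
  show "maps_with_left_inverse E_S W_S to_W from_W"
    unfolding maps_with_left_inverse_def
    by (rule exI[of _ "{}"]) (simp add: on_curve_def nz W_S_to_W from_to_W refl)
  show "maps_with_left_inverse W_S E_S from_W to_W"
    unfolding maps_with_left_inverse_def
    by (rule exI[of _ "{}"]) (simp add: on_curve_def nz E to_from_W refl)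
qed

lemma W_S_weierstrass: "W_S = weierstrass_form 0 6 0 (-3) 0"
  by (simp add: fun_eq_iff W_S_def weierstrass_form_def Let_def of_rat_minus
      power2_eq_square power3_eq_cube algebra_simps)

lemma j_invariant_E_S: "has_j_invariant E_S 54000"
  unfolding has_j_invariant_def
proof (intro exI conjI)
  show "birationally_equivalent E_S (weierstrass_form 0 6 0 (-3) 0)"
    using birationally_equivalent_E_S_W_S by (simp only: W_S_weierstrass)
qed (simp_all add: weierstrass_disc_def weierstrass_c4_def)

theorem mainTheorem5:
  fixes A B C :: "real^2"
  assumes "\<not> collinear {A, B, C}"
  shows "{P \<in> ext_plane. \<not> on_sides A B C P \<and>
            \<not> on_sides (inv (compl_map A B C) A) (inv (compl_map A B C) B)
                        (inv (compl_map A B C) C) P \<and>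
            is_translation (M_map A B C P)}
         = {bary A B C p | p. p \<noteq> 0 \<and> E_S p = 0}
           - {ord A, ord B, ord C,
              bary A B C (vector [0, 1, -1]),
              bary A B C (vector [1, 0, -1]),
              bary A B C (vector [1, -1, 0])}
       \<and> elliptic_curve E_S
       \<and> birationally_equivalent E_S W_S
       \<and> has_j_invariant E_S 54000
       \<and> (54000 :: rat) = 2^4 * 3^3 * 5^3"
  using translation_locus[OF assms] elliptic_curve_E_S birationally_equivalent_E_S_W_S
    j_invariant_E_S by (intro conjI) simp_all

end
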